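(* Let $n\ge3$ and let $P$ be the probability distribution of an Ising model on a ring of $n$ spins $s_i\in\{-1,1\}$ (indices modulo $n$), $$P(\mathbf s)=\frac1{Z_c}\exp\Bigl(\sum_{i=1}^nh_i^cs_i+\sum_{i=1}^{n}J_i^cs_is_{i+1}\Bigr),$$ factorized by belief propagation as $$P(\mathbf s)=\frac1{Z_{\rm BP}}\prod_{i=1}^n\frac{b_i^c(s_i,s_{i+1})}{b_i^c(s_i)b_{i+1}^c(s_{i+1})}\prod_{i=1}^nb_i^c(s_i),$$ with beliefs parameterized as $$b_i^c(s_i)=\tfrac12(1+\breve m_is_i),\qquad b_i^c(s_i,s_{i+1})=\tfrac14\bigl(1+\breve m_is_i+\breve m_{i+1}s_{i+1}+(\breve m_i\breve m_{i+1}+\breve\chi_i)s_is_{i+1}\bigr).$$ Let $$Q=\prod_{i=1}^n\frac{\breve\chi_i}{\sqrt{(1-\breve m_i^2)(1-\breve m_{i+1}^2)}} .$$ Then the BP normalization constant, the exact magnetizations $m_i=\mathbb E(s_i)$ and the exact susceptibilities $\chi_i=\mathbb E(s_is_{i+1})-\mathbb E(s_i)\mathbb E(s_{i+1})$ (expectations under $P$) are $$Z_{\rm BP}=1+Q,\qquad m_i=\frac{1-Q}{1+Q}\,\breve m_i,$$ $$\chi_i=\frac{\breve\chi_i}{1+Q}+\frac{Q}{1+Q}\Bigl(\frac{(1-\breve m_i^2)(1-\breve m_{i+1}^2)}{\breve\chi_i}+4\,\frac{\breve m_i\breve m_{i+1}}{1+Q}\Bigr).$$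
   Context: The beliefs at a belief propagation fixed point on the ring are positive probability distributions $b_i^c(s_i)$ and $b_i^c(s_i,s_{i+1})$ which are locally consistent (the marginals of $b_i^c(\cdot,\cdot)$ are $b_i^c$ and $b_{i+1}^c$, which is automatic in the parameterization above) and satisfy the displayed factorization of $P$, $Z_{\rm BP}$ being its normalization constant. The formula for $\chi_i$ is for $\breve\chi_i\ne0$ (for $\breve\chi_i=0$ the ratio $Q/\breve\chi_i$ is understood as the product defining $Q$ with the factor $\breve\chi_i$ omitted). *)

theory Defs
  imports "HOL-Probability.Probability"
begin

text \<open>Sites of the ring are \<open>0, \<dots>, n - 1\<close>; the index \<open>i + 1\<close> is read modulo \<open>n\<close>.\<close>

definition next_site :: "nat \<Rightarrow> nat \<Rightarrow> nat" where
  "next_site n i = Suc i mod n"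

definition configs :: "nat \<Rightarrow> (nat \<Rightarrow> real) set" where
  "configs n = {..<n} \<rightarrow>\<^sub>E {-1, 1}"

definition ising_weight :: "nat \<Rightarrow> (nat \<Rightarrow> real) \<Rightarrow> (nat \<Rightarrow> real) \<Rightarrow> (nat \<Rightarrow> real) \<Rightarrow> real" where
  "ising_weight n h J s = exp ((\<Sum>i<n. h i * s i) + (\<Sum>i<n. J i * s i * s (next_site n i)))"

definition ising_Z :: "nat \<Rightarrow> (nat \<Rightarrow> real) \<Rightarrow> (nat \<Rightarrow> real) \<Rightarrow> real" where
  "ising_Z n h J = (\<Sum>s\<in>configs n. ising_weight n h J s)"

definition ising_pmf :: "nat \<Rightarrow> (nat \<Rightarrow> real) \<Rightarrow> (nat \<Rightarrow> real) \<Rightarrow> (nat \<Rightarrow> real) pmf" where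
  "ising_pmf n h J =
     embed_pmf (\<lambda>s. if s \<in> configs n then ising_weight n h J s / ising_Z n h J else 0)"

lemma finite_configs: "finite (configs n)"
  unfolding configs_def by (intro finite_PiE) auto

lemma configs_nonempty: "configs n \<noteq> {}"
  unfolding configs_def by (simp add: PiE_eq_empty_iff)

lemma ising_Z_pos: "ising_Z n h J > 0"
  unfolding ising_Z_def ising_weight_def
  by (intro sum_pos finite_configs configs_nonempty) auto

lemma pmf_ising_pmf:
  "pmf (ising_pmf n h J) s =
     (if s \<in> configs n then ising_weight n h J s / ising_Z n h J else 0)"
  unfolding ising_pmf_def
proof (rule pmf_embed_pmf)
  let ?f = "\<lambda>s. if s \<in> configs n then ising_weight n h J s / ising_Z n h J else 0"
  show nonneg: "?f x \<ge> 0" for x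
    using ising_Z_pos[of n h J] by (auto simp: ising_weight_def)
  have "(\<integral>\<^sup>+x. ennreal (?f x) \<partial>count_space UNIV) = (\<Sum>x\<in>configs n. ennreal (?f x))"
    by (rule nn_integral_count_space'[OF finite_configs]) auto
  also have "\<dots> = ennreal (\<Sum>x\<in>configs n. ?f x)"
    by (rule sum_ennreal) (rule nonneg)
  also have "(\<Sum>x\<in>configs n. ?f x) = (\<Sum>x\<in>configs n. ising_weight n h J x / ising_Z n h J)"
    by (rule sum.cong) auto
  also have "\<dots> = 1"
    using ising_Z_pos[of n h J] by (simp add: sum_divide_distrib[symmetric] ising_Z_def)
  finally show "(\<integral>\<^sup>+x. ennreal (?f x) \<partial>count_space UNIV) = 1" by simp
qed

definition magnetization :: "(nat \<Rightarrow> real) pmf \<Rightarrow> nat \<Rightarrow> real" where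
  "magnetization P i = measure_pmf.expectation P (\<lambda>s. s i)"

definition susceptibility :: "nat \<Rightarrow> (nat \<Rightarrow> real) pmf \<Rightarrow> nat \<Rightarrow> real" where
  "susceptibility n P i =
     measure_pmf.expectation P (\<lambda>s. s i * s (next_site n i))
       - measure_pmf.expectation P (\<lambda>s. s i) * measure_pmf.expectation P (\<lambda>s. s (next_site n i))"

text \<open>Positive, locally consistent node beliefs \<open>b1 i\<close> and edge beliefs \<open>b2 i\<close>
  (on the edge from \<open>i\<close> to \<open>i + 1\<close>).\<close>

definition ring_beliefs ::
  "nat \<Rightarrow> (nat \<Rightarrow> real \<Rightarrow> real) \<Rightarrow> (nat \<Rightarrow> real \<Rightarrow> real \<Rightarrow> real) \<Rightarrow> bool" where
  "ring_beliefs n b1 b2 \<longleftrightarrow> (\<forall>i<n.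
     (\<forall>s\<in>{-1, 1}. b1 i s > 0) \<and>
     (\<Sum>s\<in>{-1, 1}. b1 i s) = 1 \<and>
     (\<forall>s\<in>{-1, 1}. \<forall>t\<in>{-1, 1}. b2 i s t > 0) \<and>
     (\<Sum>s\<in>{-1, 1}. \<Sum>t\<in>{-1, 1}. b2 i s t) = 1 \<and>
     (\<forall>s\<in>{-1, 1}. (\<Sum>t\<in>{-1, 1}. b2 i s t) = b1 i s) \<and>
     (\<forall>t\<in>{-1, 1}. (\<Sum>s\<in>{-1, 1}. b2 i s t) = b1 (next_site n i) t))"

definition bp_weight ::
  "nat \<Rightarrow> (nat \<Rightarrow> real \<Rightarrow> real) \<Rightarrow> (nat \<Rightarrow> real \<Rightarrow> real \<Rightarrow> real) \<Rightarrow> (nat \<Rightarrow> real) \<Rightarrow> real" where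
  "bp_weight n b1 b2 s =
     (\<Prod>i<n. b2 i (s i) (s (next_site n i)) / (b1 i (s i) * b1 (next_site n i) (s (next_site n i))))
       * (\<Prod>i<n. b1 i (s i))"

definition bp_Z ::
  "nat \<Rightarrow> (nat \<Rightarrow> real \<Rightarrow> real) \<Rightarrow> (nat \<Rightarrow> real \<Rightarrow> real \<Rightarrow> real) \<Rightarrow> real" where
  "bp_Z n b1 b2 = (\<Sum>s\<in>configs n. bp_weight n b1 b2 s)"

definition loop_Q :: "nat \<Rightarrow> (nat \<Rightarrow> real) \<Rightarrow> (nat \<Rightarrow> real) \<Rightarrow> real" where
  "loop_Q n m chi = (\<Prod>i<n. chi i / sqrt ((1 - (m i)\<^sup>2) * (1 - (m (next_site n i))\<^sup>2)))"

text \<open>The product defining \<open>loop_Q\<close> with only the numerator factor \<open>chi k\<close> omitted: all the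
  square roots, including the one at \<open>k\<close>, stay. It gives the meaning of \<open>loop_Q n m chi / chi k\<close>
  when \<open>chi k = 0\<close>.\<close>

definition loop_Q_omit :: "nat \<Rightarrow> (nat \<Rightarrow> real) \<Rightarrow> (nat \<Rightarrow> real) \<Rightarrow> nat \<Rightarrow> real" where
  "loop_Q_omit n m chi k =
     (\<Prod>i<n. (if i = k then 1 else chi i) / sqrt ((1 - (m i)\<^sup>2) * (1 - (m (next_site n i))\<^sup>2)))"

end

theory Submission
  imports Defs
begin

text \<open>Write \<open>f\<^sub>i(s) = s / (1 + m\<^sub>i s)\<close>.  In the belief parameterization, the edge ratio
  \<open>b\<^sub>i(s, t) / (b\<^sub>i(s) b\<^sub>i\<^sub>+\<^sub>1(t))\<close> is \<open>1 + \<chi>\<^sub>i f\<^sub>i(s) f\<^sub>i\<^sub>+\<^sub>1(t)\<close>, and \<open>f\<^sub>i\<close> has mean \<open>0\<close> and variance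
  \<open>1 / (1 - m\<^sub>i\<^sup>2)\<close> under \<open>b\<^sub>i\<close>.  Expanding the product over the edges gives a sum over edge sets, in
  which a set contributes only if every site carrying no observable has even degree.  On the ring
  this leaves the empty set and the full loop, and, for an observable on the edge \<open>k\<close>, also \<open>{k}\<close>
  and the complement of \<open>k\<close>.\<close>

section \<open>The cyclic successor of a site\<close>

lemma next_site_less: "i < n \<Longrightarrow> next_site n i < n"
  by (simp add: next_site_def)

lemma inj_on_next_site: "inj_on (next_site n) {..<n}"
proof (rule inj_onI)
  fix i j assume "i \<in> {..<n}" "j \<in> {..<n}" "next_site n i = next_site n j"
  then show "i = j"
    by (cases "Suc i = n"; cases "Suc j = n") (auto simp: next_site_def)
qed

lemma next_site_eq_iff: "i < n \<Longrightarrow> j < n \<Longrightarrow> next_site n i = next_site n j \<longleftrightarrow> i = j"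
  using inj_on_next_site[of n] by (auto simp: inj_on_def)

lemma next_site_image: "next_site n ` {..<n} = {..<n}"
  by (rule endo_inj_surj) (auto simp: next_site_less inj_on_next_site)

lemma next_site_neq: "n \<ge> 2 \<Longrightarrow> i < n \<Longrightarrow> next_site n i \<noteq> i"
  by (cases "Suc i = n") (auto simp: next_site_def)

lemma next_site_image_remove:
  "k < n \<Longrightarrow> next_site n ` ({..<n} - {k}) = {..<n} - {next_site n k}"
  by (subst inj_on_image_set_diff[OF inj_on_next_site]) (auto simp: next_site_image)

section \<open>Expansion over edge sets\<close>

text \<open>Multiplying out means choosing, for each edge, either 1 or its interaction term;
  \<open>S\<close> collects the edges where the term is chosen. Injectivity of \<open>nx\<close>
  keeps the heads of the chosen edges distinct, so site \<open>j\<close> carries \<open>f j\<close>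
  to the power of its degree in \<open>S\<close>, and the sum over configurations then factorizes
  over the sites.\<close>

lemma sum_PiE_prod_edges_expand:
  fixes w f :: "'i \<Rightarrow> 'a \<Rightarrow> 'b::comm_semiring_1" and c :: "'i \<Rightarrow> 'b"
  assumes I: "finite I" and A: "finite A" and inj: "inj_on nx I" and nx: "nx ` I \<subseteq> I"
  shows "(\<Sum>s\<in>I \<rightarrow>\<^sub>E A. (\<Prod>i\<in>I. w i (s i)) *
            (\<Prod>i\<in>I. 1 + c i * (f i (s i) * f (nx i) (s (nx i))))) =
         (\<Sum>S\<in>Pow I. prod c S *
            (\<Prod>j\<in>I. \<Sum>x\<in>A. w j x * f j x ^ (of_bool (j \<in> S) + of_bool (j \<in> nx ` S))))"
proof -
  \<comment> \<open>Exponents 0 and 1 extend a product over \<open>S\<close> to all of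
    \<open>I\<close>, so that the tail and head factors at a site merge into one power.\<close>
  have restrict: "prod g S = (\<Prod>j\<in>I. g j ^ of_bool (j \<in> S))"
    if "S \<subseteq> I" for g :: "'i \<Rightarrow> 'b" and S
  proof -
    have "prod g S = prod g (I \<inter> S)"
      using that by (simp add: Int_absorb1)
    also have "\<dots> = (\<Prod>j\<in>I. g j ^ of_bool (j \<in> S))"
      using I by (subst prod.inter_restrict) (auto intro!: prod.cong)
    finally show ?thesis .
  qed
  have expand: "(\<Prod>i\<in>I. 1 + c i * (f i (s i) * f (nx i) (s (nx i)))) =
      (\<Sum>S\<in>Pow I. prod c S *
        (\<Prod>j\<in>I. f j (s j) ^ (of_bool (j \<in> S) + of_bool (j \<in> nx ` S))))" for s
  proof -
    have "(\<Prod>i\<in>I. 1 + c i * (f i (s i) * f (nx i) (s (nx i)))) =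
        (\<Sum>S\<in>Pow I. \<Prod>i\<in>S. c i * (f i (s i) * f (nx i) (s (nx i))))"
      using prod_add[OF I, of "\<lambda>i. c i * (f i (s i) * f (nx i) (s (nx i)))" "\<lambda>_. 1"]
      by (simp add: add.commute)
    also have "\<dots> = (\<Sum>S\<in>Pow I. prod c S *
        (\<Prod>j\<in>I. f j (s j) ^ (of_bool (j \<in> S) + of_bool (j \<in> nx ` S))))"
    proof (rule sum.cong[OF refl])
      fix S assume "S \<in> Pow I"
      then have S: "S \<subseteq> I" by simp
      then have image: "nx ` S \<subseteq> I"
        using nx by blast
      have "(\<Prod>i\<in>S. f (nx i) (s (nx i))) = (\<Prod>j\<in>nx ` S. f j (s j))"
        using inj S by (subst prod.reindex) (auto intro: inj_on_subset simp: o_def)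
      also have "\<dots> = (\<Prod>j\<in>I. f j (s j) ^ of_bool (j \<in> nx ` S))"
        by (rule restrict[OF image])
      finally show "(\<Prod>i\<in>S. c i * (f i (s i) * f (nx i) (s (nx i)))) = prod c S *
          (\<Prod>j\<in>I. f j (s j) ^ (of_bool (j \<in> S) + of_bool (j \<in> nx ` S)))"
        by (simp add: prod.distrib restrict[OF S, of "\<lambda>i. f i (s i)"] power_add)
    qed
    finally show ?thesis .
  qed
  have "(\<Sum>s\<in>I \<rightarrow>\<^sub>E A. (\<Prod>i\<in>I. w i (s i)) *
          (\<Prod>i\<in>I. 1 + c i * (f i (s i) * f (nx i) (s (nx i))))) =
      (\<Sum>s\<in>I \<rightarrow>\<^sub>E A. \<Sum>S\<in>Pow I. prod c S *
        (\<Prod>j\<in>I. w j (s j) * f j (s j) ^ (of_bool (j \<in> S) + of_bool (j \<in> nx ` S))))"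
    by (simp add: expand sum_distrib_left prod.distrib mult_ac)
  also have "\<dots> = (\<Sum>S\<in>Pow I. prod c S * (\<Sum>s\<in>I \<rightarrow>\<^sub>E A.
        (\<Prod>j\<in>I. w j (s j) * f j (s j) ^ (of_bool (j \<in> S) + of_bool (j \<in> nx ` S)))))"
    by (subst sum.swap) (simp add: sum_distrib_left)
  also have "\<dots> = (\<Sum>S\<in>Pow I. prod c S *
      (\<Prod>j\<in>I. \<Sum>x\<in>A. w j x * f j x ^ (of_bool (j \<in> S) + of_bool (j \<in> nx ` S))))"
    using I A by (subst prod_sum_PiE) auto
  finally show ?thesis .
qed

section \<open>Edge sets of the ring and their degrees\<close>

text \<open>Edge sets are represented by the left endpoints of their edges.\<close>

definition ring_degree :: "nat \<Rightarrow> nat set \<Rightarrow> nat \<Rightarrow> nat" where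
  "ring_degree n S j = of_bool (j \<in> S) + of_bool (j \<in> next_site n ` S)"

lemma ring_degree_next_site:
  assumes "S \<subseteq> {..<n}" "i < n"
  shows "ring_degree n S (next_site n i) = of_bool (next_site n i \<in> S) + of_bool (i \<in> S)"
proof -
  have "next_site n i \<in> next_site n ` S \<longleftrightarrow> i \<in> S"
    using assms by (auto simp: next_site_eq_iff subset_iff)
  then show ?thesis
    by (simp add: ring_degree_def)
qed

text \<open>Away from the ends of edge \<open>k\<close> every degree is 0 or 2, so the two edges
  meeting at such a site are both in \<open>S\<close> or both outside. Hence membership is constant
  along the path of edges other than \<open>k\<close>, while \<open>k\<close> itself stays free:
  four sets in all.\<close>

lemma edge_set_cases:
  assumes k: "k < n" and S: "S \<subseteq> {..<n}"
    and even: "\<And>j. j < n \<Longrightarrow> j \<notin> {k, next_site n k} \<Longrightarrow> ring_degree n S j \<noteq> 1"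
  shows "S \<in> {{}, {k}, {..<n} - {k}, {..<n}}"
proof -
  \<comment> \<open>The walk \<open>p\<close> starts at the head of edge \<open>k\<close> and
    returns to \<open>k\<close> after \<open>n - 1\<close> steps, so the indices with
    \<open>j + 1 < n\<close> visit exactly the other sites.\<close>
  define p where "p j = (k + 1 + j) mod n" for j
  have p_less: "p j < n" for j
    using k by (simp add: p_def)
  have p_Suc: "p (Suc j) = next_site n (p j)" for j
    by (simp add: p_def next_site_def mod_Suc_eq)
  have p_neq: "p j \<noteq> k" if "j + 1 < n" for j
    using k that by (auto simp: p_def mod_if)
  have same: "p j \<in> S \<longleftrightarrow> p 0 \<in> S" if "j + 1 < n" for j
    using that
  proof (induction j)
    case (Suc j)
    have "p (Suc j) \<noteq> k"
      using Suc.prems by (intro p_neq) simp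
    moreover have "p (Suc j) \<noteq> next_site n k"
      using Suc.prems p_neq[of j] by (simp add: p_Suc next_site_eq_iff p_less k)
    ultimately have "ring_degree n S (p (Suc j)) \<noteq> 1"
      using even p_less by blast
    then have "p (Suc j) \<in> S \<longleftrightarrow> p j \<in> S"
      using ring_degree_next_site[OF S p_less[of j]] by (auto simp: p_Suc of_bool_def split: if_splits)
    then show ?case
      using Suc by simp
  qed simp
  have all: "i \<in> S \<longleftrightarrow> p 0 \<in> S" if i: "i < n" "i \<noteq> k" for i
  proof -
    obtain j where "j + 1 < n" "p j = i"
    proof (cases "k < i")
      case True
      with i have "p (i - k - 1) = i" "i - k - 1 + 1 < n"
        by (auto simp: p_def)
      then show ?thesis using that by blast
    next
      case False
      \<comment> \<open>Here \<open>i < k\<close>, so the walk passes the site \<open>n - 1\<close>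
        and wraps around before reaching \<open>i\<close>.\<close>
      with i k have "k + 1 + (i + n - k - 1) = i + n" "i + n - k - 1 + 1 < n"
        by auto
      with i have "p (i + n - k - 1) = i" "i + n - k - 1 + 1 < n"
        unfolding p_def by simp_all
      then show ?thesis using that by blast
    qed
    then show ?thesis
      using same by metis
  qed
  show ?thesis
  proof (cases "p 0 \<in> S")
    case True
    then have "{..<n} - {k} \<subseteq> S"
      using all by blast
    then have "S = {..<n} - {k} \<or> S = {..<n}"
      using S by blast
    then show ?thesis by blast
  next
    case False
    then have "S \<subseteq> {k}"
      using all S by blast
    then show ?thesis by blast
  qed
qed

text \<open>\<open>M j d\<close> stands for the local factor of site \<open>j\<close> at degree
  \<open>d\<close>. A site of degree 1 off the edge \<open>k\<close> annihilates its term. The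
  survivors are, in order, the empty set, \<open>{k}\<close>, the full loop and the complement of
  \<open>k\<close>; the two ends of \<open>k\<close> have degrees 0, 1, 2 and 1 in them.\<close>

lemma sum_edge_sets:
  fixes c v :: "nat \<Rightarrow> 'a::idom" and M :: "nat \<Rightarrow> nat \<Rightarrow> 'a"
  assumes n: "n \<ge> 2" and k: "k < n"
    and M: "\<And>j. j < n \<Longrightarrow> j \<notin> {k, next_site n k} \<Longrightarrow> M j 0 = 1 \<and> M j 1 = 0 \<and> M j 2 = v j"
  defines "k' \<equiv> next_site n k"
  shows "(\<Sum>S\<in>Pow {..<n}. prod c S * (\<Prod>j<n. M j (ring_degree n S j))) =
      M k 0 * M k' 0 + c k * (M k 1 * M k' 1)
      + prod c {..<n} * prod v ({..<n} - {k, k'}) * (M k 2 * M k' 2)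
      + prod c ({..<n} - {k}) * prod v ({..<n} - {k, k'}) * (M k 1 * M k' 1)"
proof -
  have k': "k' < n" "k' \<noteq> k"
    using n k by (auto simp: k'_def next_site_less next_site_neq)
  define T where "T S = prod c S * (\<Prod>j<n. M j (ring_degree n S j))" for S
  let ?R = "{..<n} - {k, k'}"
  have "(\<Prod>j<n. g j) = g k * (\<Prod>j\<in>{..<n} - {k}. g j)" for g :: "nat \<Rightarrow> 'a"
    using k by (intro prod.remove) auto
  moreover have "(\<Prod>j\<in>{..<n} - {k}. g j) = g k' * (\<Prod>j\<in>?R. g j)" for g :: "nat \<Rightarrow> 'a"
    using k' by (subst prod.remove[of _ k']) (auto intro!: arg_cong2[of _ _ _ _ "(*)"] prod.cong)
  ultimately have prod_split: "(\<Prod>j<n. g j) = g k * g k' * (\<Prod>j\<in>?R. g j)" for g :: "nat \<Rightarrow> 'a"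
    by (simp add: mult.assoc)
  have M': "M j 0 = 1" "M j (Suc 0) = 0" "M j 2 = v j" if "j \<in> ?R" for j
    using M[of j] that by (auto simp: k'_def)
  have T_zero: "T S = 0" if S: "S \<in> Pow {..<n} - {{}, {k}, {..<n} - {k}, {..<n}}" for S
  proof -
    obtain j where "j < n" "j \<notin> {k, next_site n k}" "ring_degree n S j = 1"
      using edge_set_cases[OF k, of S] S by blast
    then have "\<exists>j\<in>{..<n}. M j (ring_degree n S j) = 0"
      using M by force
    then show ?thesis
      unfolding T_def by (subst prod_zero) auto
  qed
  have "T {} = M k 0 * M k' 0"
    unfolding T_def prod_split by (simp add: ring_degree_def M')
  moreover have "T {k} = c k * (M k 1 * M k' 1)"
  proof -
    have "(\<Prod>j\<in>?R. M j (ring_degree n {k} j)) = 1"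
      by (intro prod.neutral) (auto simp: ring_degree_def M' k'_def[symmetric])
    then show ?thesis
      unfolding T_def prod_split using k' by (simp add: ring_degree_def k'_def[symmetric])
  qed
  moreover have "T {..<n} = prod c {..<n} * prod v ?R * (M k 2 * M k' 2)"
  proof -
    have "ring_degree n {..<n} j = 2" if "j < n" for j
      using that by (simp add: ring_degree_def next_site_image)
    then show ?thesis
      unfolding T_def prod_split using k k' by (simp add: M')
  qed
  moreover have "T ({..<n} - {k}) = prod c ({..<n} - {k}) * prod v ?R * (M k 1 * M k' 1)"
  proof -
    have deg: "ring_degree n ({..<n} - {k}) j = (if j = k \<or> j = k' then 1 else 2)" if "j < n" for j
      using that k k' by (auto simp: ring_degree_def next_site_image_remove k'_def[symmetric])
    have "(\<Prod>j\<in>?R. M j (ring_degree n ({..<n} - {k}) j)) = prod v ?R"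
      by (intro prod.cong) (auto simp: deg M')
    then show ?thesis
      unfolding T_def prod_split using k k' by (simp add: deg)
  qed
  moreover have "(\<Sum>S\<in>Pow {..<n}. T S) = T {} + T {k} + T {..<n} + T ({..<n} - {k})"
  proof -
    \<comment> \<open>The four sets must be distinct for the sum over them to split into four terms;
      the second site \<open>k'\<close> separates them.\<close>
    have "{} \<noteq> {..<n} - {k}" "{k} \<noteq> {..<n} - {k}" "{k} \<noteq> {..<n}" "{} \<noteq> {..<n}" "{..<n} - {k} \<noteq> {..<n}"
      using k k' by auto
    moreover have "(\<Sum>S\<in>Pow {..<n}. T S) = (\<Sum>S\<in>{{}, {k}, {..<n} - {k}, {..<n}}. T S)"
      using k T_zero by (intro sum.mono_neutral_right) auto
    ultimately show ?thesis
      by (simp add: add_ac)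
  qed
  ultimately show ?thesis
    by (simp only: T_def[symmetric])
qed

text \<open>Around the ring each site's square root occurs twice, once for each incident edge. The
  numerators \<open>c\<close> are left arbitrary to cover both \<open>loop_Q\<close> and
  \<open>loop_Q_omit\<close>.\<close>

lemma prod_divide_sqrt_ring:
  fixes c m :: "nat \<Rightarrow> real"
  assumes "\<And>i. i < n \<Longrightarrow> \<bar>m i\<bar> < 1"
  shows "(\<Prod>i<n. c i / sqrt ((1 - (m i)\<^sup>2) * (1 - (m (next_site n i))\<^sup>2))) =
         prod c {..<n} * (\<Prod>i<n. 1 / (1 - (m i)\<^sup>2))"
proof -
  have pos: "1 - (m i)\<^sup>2 > 0" if "i < n" for i
    using assms[OF that] by (simp add: abs_square_less_1)
  have shift: "(\<Prod>i<n. sqrt (1 - (m (next_site n i))\<^sup>2)) = (\<Prod>i<n. sqrt (1 - (m i)\<^sup>2))"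
    using prod.reindex[OF inj_on_next_site, of "\<lambda>i. sqrt (1 - (m i)\<^sup>2)" n]
    by (simp add: next_site_image o_def)
  have "(\<Prod>i<n. sqrt ((1 - (m i)\<^sup>2) * (1 - (m (next_site n i))\<^sup>2))) =
      (\<Prod>i<n. sqrt (1 - (m i)\<^sup>2)) * (\<Prod>i<n. sqrt (1 - (m i)\<^sup>2))"
    by (simp add: real_sqrt_mult prod.distrib shift)
  also have "\<dots> = (\<Prod>i<n. sqrt (1 - (m i)\<^sup>2) * sqrt (1 - (m i)\<^sup>2))"
    by (simp only: prod.distrib)
  also have "\<dots> = (\<Prod>i<n. 1 - (m i)\<^sup>2)"
    using pos by (intro prod.cong) (auto simp: less_imp_le)
  finally show ?thesis
    by (simp add: prod_dividef)
qed

section \<open>Expectations and single-spin moments\<close>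

lemma expectation_ising_pmf:
  "measure_pmf.expectation (ising_pmf n h J) F = (\<Sum>s\<in>configs n. F s * pmf (ising_pmf n h J) s)"
  by (rule integral_measure_pmf_real[OF finite_configs])
     (auto simp: set_pmf_eq pmf_ising_pmf split: if_splits)

text \<open>The site factor of the expansion: a mean under the node belief with magnetization
  \<open>\<mu>\<close>, where \<open>e\<close> is the power of the spin in the observable and
  \<open>d\<close> the degree of the site in the edge set.\<close>

definition spin_moment :: "real \<Rightarrow> nat \<Rightarrow> nat \<Rightarrow> real" where
  "spin_moment \<mu> e d = (\<Sum>x\<in>{-1, 1}. 1/2 * (1 + \<mu> * x) * x ^ e * (x / (1 + \<mu> * x)) ^ d)"

lemma spin_moment_simps:
  assumes "\<bar>\<mu>\<bar> < 1"
  shows "spin_moment \<mu> 0 0 = 1" "spin_moment \<mu> 0 1 = 0" "spin_moment \<mu> 0 2 = 1 / (1 - \<mu>\<^sup>2)"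
    and "spin_moment \<mu> 1 0 = \<mu>" "spin_moment \<mu> 1 1 = 1" "spin_moment \<mu> 1 2 = - \<mu> / (1 - \<mu>\<^sup>2)"
proof -
  have nz: "1 + \<mu> \<noteq> 0" "1 - \<mu> \<noteq> 0"
    using assms by auto
  have sq: "1 - \<mu>\<^sup>2 = (1 + \<mu>) * (1 - \<mu>)"
    by (simp add: power2_eq_square algebra_simps)
  have "\<mu> * \<mu> \<noteq> 1"
    using nz sq by (auto simp: power2_eq_square)
  have two: "spin_moment \<mu> e 2 = (1 / (1 + \<mu>) + (-1) ^ e / (1 - \<mu>)) / 2" for e
  proof -
    \<comment> \<open>The belief weight \<open>a\<close> cancels only one of the two denominators,
      so a factor \<open>1 / a\<close> survives at degree 2.\<close>
    have cancel: "1/2 * a * y * (x / a)\<^sup>2 = y * x\<^sup>2 / a / 2" if "a \<noteq> 0" for a x y :: real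
      using that by (simp add: power2_eq_square)
    have "spin_moment \<mu> e 2 = 1/2 * (1 + \<mu>) * 1 * (1 / (1 + \<mu>))\<^sup>2 +
        1/2 * (1 - \<mu>) * (-1) ^ e * (-1 / (1 - \<mu>))\<^sup>2"
      by (simp add: spin_moment_def)
    then show ?thesis
      by (simp only: cancel[OF nz(1)] cancel[OF nz(2)]) (simp add: add_divide_distrib)
  qed
  show "spin_moment \<mu> 0 2 = 1 / (1 - \<mu>\<^sup>2)" "spin_moment \<mu> 1 2 = - \<mu> / (1 - \<mu>\<^sup>2)"
    unfolding two sq using nz by (simp_all add: divide_simps)
  show "spin_moment \<mu> 0 0 = 1" "spin_moment \<mu> 0 1 = 0" "spin_moment \<mu> 1 0 = \<mu>" "spin_moment \<mu> 1 1 = 1"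
    using nz \<open>\<mu> * \<mu> \<noteq> 1\<close> by (simp_all add: spin_moment_def field_simps)
qed

text \<open>The edge belief is the product of the two node beliefs plus a quarter of
  \<open>c * s * t\<close>.\<close>

lemma edge_ratio_eq:
  fixes s t \<mu> \<nu> c :: real
  assumes "1 + \<mu> * s \<noteq> 0" "1 + \<nu> * t \<noteq> 0"
  shows "1/4 * (1 + \<mu> * s + \<nu> * t + (\<mu> * \<nu> + c) * s * t) / (1/2 * (1 + \<mu> * s) * (1/2 * (1 + \<nu> * t))) =
         1 + c * (s / (1 + \<mu> * s) * (t / (1 + \<nu> * t)))"
  using assms by (simp add: divide_simps) (simp add: algebra_simps)

section \<open>Unnormalized moments of the belief propagation weight\<close>

text \<open>Node beliefs and powers of spins form the site weights, and the edge ratios have the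
  form \<open>1 + chi i * ...\<close> required by the expansion. Off the edge \<open>k\<close> the
  observable is trivial, so the moments there are 1, 0 and \<open>1 / (1 - (m j)\<^sup>2)\<close>,
  as \<open>sum_edge_sets\<close> demands.\<close>

lemma ring_moment:
  fixes m chi :: "nat \<Rightarrow> real"
  assumes n: "n \<ge> 2" and k: "k < n"
    and pos: "\<And>i s. i < n \<Longrightarrow> s \<in> {-1, 1} \<Longrightarrow> 0 < b1 i s"
    and b1: "\<And>i s. i < n \<Longrightarrow> s \<in> {-1, 1} \<Longrightarrow> b1 i s = 1/2 * (1 + m i * s)"
    and b2: "\<And>i s t. i < n \<Longrightarrow> s \<in> {-1, 1} \<Longrightarrow> t \<in> {-1, 1} \<Longrightarrow>
      b2 i s t = 1/4 * (1 + m i * s + m (next_site n i) * t + (m i * m (next_site n i) + chi i) * s * t)"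
    and e: "\<And>j. j < n \<Longrightarrow> j \<notin> {k, next_site n k} \<Longrightarrow> e j = 0"
  defines "k' \<equiv> next_site n k"
  defines "V \<equiv> (\<Prod>i\<in>{..<n} - {k, k'}. 1 / (1 - (m i)\<^sup>2))"
    and "\<mu> \<equiv> \<lambda>j. spin_moment (m j) (e j)"
  shows "(\<Sum>s\<in>configs n. bp_weight n b1 b2 s * (\<Prod>i<n. s i ^ e i)) =
      \<mu> k 0 * \<mu> k' 0 + chi k * (\<mu> k 1 * \<mu> k' 1)
      + prod chi {..<n} * V * (\<mu> k 2 * \<mu> k' 2)
      + prod chi ({..<n} - {k}) * V * (\<mu> k 1 * \<mu> k' 1)"
proof -
  define f where "f i x = x / (1 + m i * x)" for i and x :: real
  define w where "w i x = 1/2 * (1 + m i * x) * x ^ e i" for i and x :: real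
  have m: "\<bar>m i\<bar> < 1" if "i < n" for i
    using pos[OF that, of 1] pos[OF that, of "-1"] b1[OF that, of 1] b1[OF that, of "-1"] by simp
  have nz: "1 + m i * x \<noteq> 0" if "i < n" "x \<in> {-1, 1}" for i x
    using m[OF that(1)] that(2) by auto
  have weight: "bp_weight n b1 b2 s * (\<Prod>i<n. s i ^ e i) =
      (\<Prod>i<n. w i (s i)) * (\<Prod>i<n. 1 + chi i * (f i (s i) * f (next_site n i) (s (next_site n i))))"
    if "s \<in> configs n" for s
  proof -
    have s: "s i \<in> {-1, 1}" if "i < n" for i
      using \<open>s \<in> configs n\<close> that unfolding configs_def by (auto dest: PiE_mem)
    have "(\<Prod>i<n. b2 i (s i) (s (next_site n i)) / (b1 i (s i) * b1 (next_site n i) (s (next_site n i)))) =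
        (\<Prod>i<n. 1 + chi i * (f i (s i) * f (next_site n i) (s (next_site n i))))"
    proof (rule prod.cong[OF refl])
      fix i assume "i \<in> {..<n}"
      then have i: "i < n" "next_site n i < n"
        by (simp_all add: next_site_less)
      show "b2 i (s i) (s (next_site n i)) / (b1 i (s i) * b1 (next_site n i) (s (next_site n i))) =
          1 + chi i * (f i (s i) * f (next_site n i) (s (next_site n i)))"
        using edge_ratio_eq[OF nz nz, OF i(1) s i(2) s, OF i]
        by (simp only: b1[OF i(1) s] b1[OF i(2) s] b2[OF i(1) s s] i f_def)
    qed
    moreover have "(\<Prod>i<n. b1 i (s i)) = (\<Prod>i<n. 1/2 * (1 + m i * s i))"
      using b1 s by (intro prod.cong) auto
    ultimately show ?thesis
      by (simp only: bp_weight_def w_def prod.distrib mult_ac)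
  qed
  have "(\<Sum>s\<in>configs n. bp_weight n b1 b2 s * (\<Prod>i<n. s i ^ e i)) =
      (\<Sum>s\<in>{..<n} \<rightarrow>\<^sub>E {-1, 1}. (\<Prod>i<n. w i (s i)) *
        (\<Prod>i<n. 1 + chi i * (f i (s i) * f (next_site n i) (s (next_site n i)))))"
    unfolding configs_def[symmetric] by (intro sum.cong refl weight)
  also have "\<dots> = (\<Sum>S\<in>Pow {..<n}. prod chi S *
      (\<Prod>j<n. \<Sum>x\<in>{-1, 1}. w j x * f j x ^ (of_bool (j \<in> S) + of_bool (j \<in> next_site n ` S))))"
    by (rule sum_PiE_prod_edges_expand) (auto simp: inj_on_next_site next_site_less)
  also have "\<dots> = (\<Sum>S\<in>Pow {..<n}. prod chi S * (\<Prod>j<n. \<mu> j (ring_degree n S j)))"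
    by (simp only: \<mu>_def spin_moment_def w_def f_def ring_degree_def)
  also have "\<dots> = \<mu> k 0 * \<mu> k' 0 + chi k * (\<mu> k 1 * \<mu> k' 1)
      + prod chi {..<n} * V * (\<mu> k 2 * \<mu> k' 2)
      + prod chi ({..<n} - {k}) * V * (\<mu> k 1 * \<mu> k' 1)"
    unfolding V_def k'_def
  proof (rule sum_edge_sets[OF n k])
    fix j assume j: "j < n" "j \<notin> {k, next_site n k}"
    show "\<mu> j 0 = 1 \<and> \<mu> j 1 = 0 \<and> \<mu> j 2 = 1 / (1 - (m j)\<^sup>2)"
      unfolding \<mu>_def e[OF j] using spin_moment_simps[OF m[OF j(1)]] by blast
  qed
  finally show ?thesis .
qed

section \<open>Normalization, magnetizations and susceptibilities\<close>

theorem proposition5p2: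
  fixes n :: nat
    and h J m chi :: "nat \<Rightarrow> real"
    and b1 :: "nat \<Rightarrow> real \<Rightarrow> real"
    and b2 :: "nat \<Rightarrow> real \<Rightarrow> real \<Rightarrow> real"
    and P :: "(nat \<Rightarrow> real) pmf"
    and Q :: real
  assumes "n \<ge> 3"
    and "P = ising_pmf n h J"
    and "ring_beliefs n b1 b2"
    and "\<forall>s\<in>configs n. pmf P s =
           1 / bp_Z n b1 b2 *
             ((\<Prod>i<n. b2 i (s i) (s (next_site n i)) / (b1 i (s i) * b1 (next_site n i) (s (next_site n i))))
               * (\<Prod>i<n. b1 i (s i)))"
    and "\<forall>i<n. \<forall>s\<in>{-1, 1}. b1 i s = 1/2 * (1 + m i * s)"
    and "\<forall>i<n. \<forall>s\<in>{-1, 1}. \<forall>t\<in>{-1, 1}.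
           b2 i s t = 1/4 * (1 + m i * s + m (next_site n i) * t + (m i * m (next_site n i) + chi i) * s * t)"
    and "Q = loop_Q n m chi"
  shows "bp_Z n b1 b2 = 1 + Q
    \<and> (\<forall>i<n. magnetization P i = (1 - Q) / (1 + Q) * m i)
    \<and> (\<forall>i<n. chi i \<noteq> 0 \<longrightarrow>
         susceptibility n P i =
           chi i / (1 + Q)
             + Q / (1 + Q) * ((1 - (m i)\<^sup>2) * (1 - (m (next_site n i))\<^sup>2) / chi i
                               + 4 * (m i * m (next_site n i) / (1 + Q))))
    \<and> (\<forall>i<n. chi i = 0 \<longrightarrow>
         susceptibility n P i =
           chi i / (1 + Q)
             + 1 / (1 + Q) * (loop_Q_omit n m chi i * ((1 - (m i)\<^sup>2) * (1 - (m (next_site n i))\<^sup>2))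
                               + 4 * Q * (m i * m (next_site n i) / (1 + Q))))"
proof -
  have n: "n \<ge> 2"
    using assms(1) by simp
  note P = assms(2) and P_bp = assms(4)
  have pos: "0 < b1 i s" if "i < n" "s \<in> {-1, 1}" for i s
    using assms(3) that unfolding ring_beliefs_def by blast
  have pos2: "0 < b2 i s t" if "i < n" "s \<in> {-1, 1}" "t \<in> {-1, 1}" for i s t
    using assms(3) that unfolding ring_beliefs_def by blast
  have b1: "b1 i s = 1/2 * (1 + m i * s)" if "i < n" "s \<in> {-1, 1}" for i s
    using assms(5) that by blast
  have b2: "b2 i s t = 1/4 * (1 + m i * s + m (next_site n i) * t + (m i * m (next_site n i) + chi i) * s * t)"
    if "i < n" "s \<in> {-1, 1}" "t \<in> {-1, 1}" for i s t
    using assms(6) that by blast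
  have m: "\<bar>m i\<bar> < 1" if "i < n" for i
    using pos[of i 1] pos[of i "-1"] b1[of i 1] b1[of i "-1"] that by auto
  define v where "v i = 1 / (1 - (m i)\<^sup>2)" for i
  have v: "v i \<noteq> 0" "1 - (m i)\<^sup>2 = 1 / v i" if "i < n" for i
    using m[OF that] abs_square_less_1[of "m i"] by (auto simp: v_def)
  have Q: "Q = prod chi {..<n} * prod v {..<n}"
    unfolding assms(7) loop_Q_def v_def[abs_def] by (rule prod_divide_sqrt_ring[OF m])
  \<comment> \<open>One family covers all three quantities: exponent 0 everywhere gives the
    normalization, a single 1 a magnetization, and a 1 at both ends of an edge a
    correlation.\<close>
  define W where "W e = (\<Sum>s\<in>configs n. bp_weight n b1 b2 s * (\<Prod>i<n. s i ^ e i))" for e :: "nat \<Rightarrow> nat"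
  note moment = ring_moment[where ?b1.0 = b1 and ?b2.0 = b2 and m = m and chi = chi, OF n _ pos b1 b2, folded W_def v_def]
  have Z: "bp_Z n b1 b2 = W (\<lambda>_. 0)"
    by (simp add: bp_Z_def W_def)
  have expectation: "measure_pmf.expectation P F = W e / bp_Z n b1 b2"
    if F: "\<And>s. F s = (\<Prod>i<n. s i ^ e i)" for F and e :: "nat \<Rightarrow> nat"
  proof -
    have "measure_pmf.expectation P F = (\<Sum>s\<in>configs n. F s * pmf P s)"
      unfolding P by (rule expectation_ising_pmf)
    also have "\<dots> = (\<Sum>s\<in>configs n. bp_weight n b1 b2 s * (\<Prod>i<n. s i ^ e i) / bp_Z n b1 b2)"
      using P_bp by (intro sum.cong) (simp_all add: F bp_weight_def)
    finally show ?thesis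
      by (simp add: W_def sum_divide_distrib)
  qed
  have single: "s k = (\<Prod>i<n. s i ^ of_bool (i = k))" if "k < n" for s :: "nat \<Rightarrow> real" and k
  proof -
    have "(\<Prod>i<n. s i ^ of_bool (i = k)) = (\<Prod>i<n. if i = k then s i else 1)"
      by (intro prod.cong) auto
    then show ?thesis
      using that by simp
  qed
  have site: "bp_Z n b1 b2 = 1 + Q \<and> magnetization P k = (1 - Q) * m k / bp_Z n b1 b2 \<and>
      measure_pmf.expectation P (\<lambda>s. s k * s (next_site n k)) =
        ((1 + Q) * (m k * m (next_site n k)) + chi k
          + prod chi ({..<n} - {k}) * prod v {..<n} / (v k * v (next_site n k))) / bp_Z n b1 b2"
    if k: "k < n" for k
  proof -
    let ?k = "next_site n k" and ?V = "prod v ({..<n} - {k, next_site n k})"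
    have k': "?k < n" "?k \<noteq> k"
      using k n by (simp_all add: next_site_less next_site_neq)
    have V: "prod v {..<n} = v k * v ?k * ?V"
    proof -
      have "{..<n} - {k} - {?k} = {..<n} - {k, ?k}"
        by blast
      then show ?thesis
        using k k' by (simp add: prod.remove[of "{..<n}" k] prod.remove[of "{..<n} - {k}" ?k])
    qed
    note spin = spin_moment_simps[OF m[OF k], folded v_def] spin_moment_simps[OF m[OF k'(1)], folded v_def]
    have spin2: "spin_moment (m k) 1 2 = - m k * v k" "spin_moment (m ?k) 1 2 = - m ?k * v ?k"
      using spin by (simp_all add: v_def)
    have "W (\<lambda>_. 0) = 1 + Q"
      using moment[OF k, of "\<lambda>_. 0"] by (simp only: spin) (simp add: Q V)
    \<comment> \<open>The empty set gives \<open>m k\<close> and the full loop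
      \<open>- Q * m k\<close>; the other two sets vanish because the end without a spin has degree
      1.\<close>
    moreover have "W (\<lambda>i. of_bool (i = k)) = (1 - Q) * m k"
    proof -
      have "of_bool (k = k) = (1 :: nat)" "of_bool (?k = k) = (0 :: nat)"
        using k' by simp_all
      then show ?thesis
        using moment[OF k, of "\<lambda>i. of_bool (i = k)"]
        by (simp only: spin(1-5,7-11) spin2) (simp add: Q V algebra_simps)
    qed
    \<comment> \<open>In the loop term the two minus signs cancel. The set \<open>{k}\<close> and
      its complement now contribute, since spin and degree 1 at both ends give moment 1.\<close>
    moreover have "W (\<lambda>i. of_bool (i = k) + of_bool (i = ?k)) = (1 + Q) * (m k * m ?k) + chi k
        + prod chi ({..<n} - {k}) * prod v {..<n} / (v k * v ?k)"
    proof -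
      have "of_bool (k = k) + of_bool (k = ?k) = (1 :: nat)" "of_bool (?k = k) + of_bool (?k = ?k) = (1 :: nat)"
        using k' by simp_all
      then show ?thesis
        using moment[OF k, of "\<lambda>i. of_bool (i = k) + of_bool (i = ?k)"] v(1)[OF k] v(1)[OF k'(1)]
        by (simp only: spin(1-5,7-11) spin2) (simp add: Q V algebra_simps)
    qed
    moreover have "magnetization P k = W (\<lambda>i. of_bool (i = k)) / bp_Z n b1 b2"
      unfolding magnetization_def by (rule expectation) (rule single[OF k])
    moreover have "measure_pmf.expectation P (\<lambda>s. s k * s ?k) =
        W (\<lambda>i. of_bool (i = k) + of_bool (i = ?k)) / bp_Z n b1 b2"
      by (rule expectation) (simp only: power_add prod.distrib single[OF k, symmetric] single[OF k'(1), symmetric])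
    ultimately show ?thesis
      by (simp only: Z)
  qed
  have Z_Q: "bp_Z n b1 b2 = 1 + Q"
    using site[of 0] n by simp
  \<comment> \<open>Positivity of the beliefs makes the denominator \<open>1 + Q\<close>
    positive.\<close>
  have "0 < bp_Z n b1 b2"
    unfolding bp_Z_def
  proof (rule sum_pos[OF finite_configs configs_nonempty])
    fix s assume "s \<in> configs n"
    then have "s i \<in> {-1, 1}" if "i < n" for i
      using that unfolding configs_def by (auto dest: PiE_mem)
    then show "0 < bp_weight n b1 b2 s"
      unfolding bp_weight_def
      by (intro mult_pos_pos prod_pos ballI divide_pos_pos pos pos2) (auto simp: next_site_less)
  qed
  then have Q_pos: "1 + Q > 0"
    by (simp add: Z_Q)
  have mag: "magnetization P k = (1 - Q) / (1 + Q) * m k" if "k < n" for k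
    using site[OF that] by (simp add: Z_Q)
  \<comment> \<open>Stated with the product lacking \<open>chi k\<close> in place of
    \<open>Q / chi k\<close>, so that it serves both zero and nonzero \<open>chi k\<close>.\<close>
  have susc: "susceptibility n P k = chi k / (1 + Q) + 1 / (1 + Q) *
      (prod chi ({..<n} - {k}) * prod v {..<n} * ((1 - (m k)\<^sup>2) * (1 - (m (next_site n k))\<^sup>2))
        + 4 * Q * (m k * m (next_site n k) / (1 + Q)))" if k: "k < n" for k
  proof -
    have k': "next_site n k < n"
      using k by (rule next_site_less)
    define X where "X = prod chi ({..<n} - {k}) * prod v {..<n} / (v k * v (next_site n k))"
    have X: "prod chi ({..<n} - {k}) * prod v {..<n} * ((1 - (m k)\<^sup>2) * (1 - (m (next_site n k))\<^sup>2)) = X"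
      by (simp add: X_def v[OF k] v[OF k'])
    have "susceptibility n P k = ((1 + Q) * (m k * m (next_site n k)) + chi k + X) / (1 + Q)
        - (1 - Q) / (1 + Q) * m k * ((1 - Q) / (1 + Q) * m (next_site n k))"
      using site[OF k] mag[OF k] mag[OF k']
      by (simp add: susceptibility_def magnetization_def Z_Q X_def)
    \<comment> \<open>The factor 4 comes from
      \<open>(1 + Q)\<^sup>2 - (1 - Q)\<^sup>2 = 4 * Q\<close>.\<close>
    also have "\<dots> = chi k / (1 + Q) + 1 / (1 + Q) * (X + 4 * Q * (m k * m (next_site n k) / (1 + Q)))"
      using Q_pos by (simp add: divide_simps) (simp add: algebra_simps)
    finally show ?thesis
      by (simp only: X)
  qed
  have omit: "loop_Q_omit n m chi k = prod chi ({..<n} - {k}) * prod v {..<n}" if "k < n" for k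
  proof -
    have "(\<Prod>i<n. if i = k then 1 else chi i) = prod chi ({..<n} - {k})"
      using that by (subst prod.remove[of _ k]) auto
    then show ?thesis
      unfolding loop_Q_omit_def v_def[abs_def] by (subst prod_divide_sqrt_ring[OF m]) auto
  qed
  have Q_remove: "Q = chi k * (prod chi ({..<n} - {k}) * prod v {..<n})" if "k < n" for k
    using that by (simp add: Q prod.remove[of "{..<n}" k chi] mult.assoc)
  have "susceptibility n P k = chi k / (1 + Q) + Q / (1 + Q) *
      ((1 - (m k)\<^sup>2) * (1 - (m (next_site n k))\<^sup>2) / chi k + 4 * (m k * m (next_site n k) / (1 + Q)))"
    if "k < n" "chi k \<noteq> 0" for k
  proof -
    have "prod chi ({..<n} - {k}) * prod v {..<n} = Q / chi k"
      using Q_remove[OF that(1)] that(2) by simp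
    then show ?thesis
      unfolding susc[OF that(1)] by (simp add: distrib_left)
  qed
  then show ?thesis
    using Z_Q mag susc omit by simp
qed

end
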